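(* Let $T$ be an Aronszajn tree. Then $\mathcal{X}_T$ is a bisequential space.
   Context: A tree is a partially ordered set $(T,<)$ such that for every $t\in T$ the set $\{s\in T: s<t\}$ is well-ordered by $<$; the height of $t$ is the order type of this set, the $\alpha$th level of $T$ is the set of elements of height $\alpha$, and the height of $T$ is the least $\alpha$ whose level is empty. A branch is a maximal chain. An Aronszajn tree is a tree of height $\omega_1$ all of whose levels and all of whose branches are at most countable. A partial function $f:T\to T$ is strictly decreasing if for all $s<t$ in the domain of $f$ one has $f(t)<f(s)$. It is strongly strictly decreasing if it is strictly decreasing and its domain is a totally ordered subset of $T$. The empty function is allowed. Define $$\mathcal{X}_T=\{1_F\in\{0,1\}^{T\times T}: F \text{ is the graph of a strongly strictly decreasing partial function } T\to T\},$$ with the subspace topology inherited from the product topology on $\{0,1\}^{T\times T}$; here $1_F$ is the characteristic function of $F\subset T\times T$. Bisequentiality: a sequence $\{A_n\}_{n\in\omega}$ of non-empty subsets of a topological space $X$ converges to $x\in X$ if for every neighborhood $U$ of $x$ there is $n_0\in\omega$ with $A_n\subset U$ for all $n>n_0$. An ultrafilter $\mathcal{U}\subset\mathcal{P}(X)$ converges to $x$ if every neighborhood of $x$ belongs to $\mathcal{U}$. $X$ is bisequential at $x$ if every ultrafilter on $X$ converging to $x$ contains a decreasing sequence $\{U_n\}_{n\in\omega}$ converging to $x$; $X$ is bisequential if it is bisequential at each of its points. *)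

theory Defs
  imports "HOL-Analysis.Analysis"
begin

unbundle cardinal_syntax

section \<open>Trees\<close>

text \<open>
  An order on \<open>T\<close> is given by its reflexive relation \<open>r\<close>, as in the library's theory of
  well-orders; \<open>s < t\<close> means \<open>(s, t) \<in> r - Id\<close>, and \<open>{s \<in> T. s < t}\<close> is \<open>underS r t\<close>.
\<close>

definition is_tree :: "'a set \<Rightarrow> 'a rel \<Rightarrow> bool" where
  "is_tree T r \<longleftrightarrow> partial_order_on T r \<and>
     (\<forall>t\<in>T. well_order_on (underS r t) (Restr r (underS r t)))"

text \<open>
  Ordinals are represented by well-orders up to the isomorphism \<open>=o\<close>, so \<open>Restr r (underS r t)\<close>
  represents the height of \<open>t\<close>.
\<close>

definition level :: "'a set \<Rightarrow> 'a rel \<Rightarrow> 'b rel \<Rightarrow> 'a set" where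
  "level T r \<alpha> = {t\<in>T. Restr r (underS r t) =o \<alpha>}"

text \<open>
  The height of the tree is \<open>\<alpha>\<close>. Every ordinal below \<open>\<alpha>\<close> is represented by a well-order on
  the same type as \<open>\<alpha>\<close> (a restriction of \<open>\<alpha>\<close> to an initial segment), so \<open>\<beta>\<close> ranges over all
  ordinals less than \<open>\<alpha>\<close>.
\<close>

definition tree_height_is :: "'a set \<Rightarrow> 'a rel \<Rightarrow> 'b rel \<Rightarrow> bool" where
  "tree_height_is T r \<alpha> \<longleftrightarrow> Well_order \<alpha> \<and> level T r \<alpha> = {} \<and>
     (\<forall>\<beta>::'b rel. \<beta> <o \<alpha> \<longrightarrow> level T r \<beta> \<noteq> {})"

definition branch :: "'a rel \<Rightarrow> 'a set \<Rightarrow> bool" where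
  "branch r B \<longleftrightarrow> B \<in> Chains r \<and> (\<forall>C\<in>Chains r. B \<subseteq> C \<longrightarrow> C = B)"

text \<open>
  \<open>cardSuc natLeq\<close> is the initial ordinal \<open>\<omega>\<^sub>1\<close>. Every nonempty level of the tree is the
  level of some well-order on (a subset of) the type \<open>'a\<close>, so \<open>\<alpha>\<close> ranges over all levels.
\<close>

definition aronszajn_tree :: "'a set \<Rightarrow> 'a rel \<Rightarrow> bool" where
  "aronszajn_tree T r \<longleftrightarrow> is_tree T r \<and> tree_height_is T r (cardSuc natLeq) \<and>
     (\<forall>\<alpha>::'a rel. Well_order \<alpha> \<longrightarrow> countable (level T r \<alpha>)) \<and>
     (\<forall>B. branch r B \<longrightarrow> countable B)"


section \<open>The space of strongly strictly decreasing partial functions\<close>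

definition partial_function_on :: "'a set \<Rightarrow> ('a \<rightharpoonup> 'a) \<Rightarrow> bool" where
  "partial_function_on T f \<longleftrightarrow> dom f \<subseteq> T \<and> ran f \<subseteq> T"

definition strictly_decreasing :: "'a rel \<Rightarrow> ('a \<rightharpoonup> 'a) \<Rightarrow> bool" where
  "strictly_decreasing r f \<longleftrightarrow>
     (\<forall>s\<in>dom f. \<forall>t\<in>dom f. (s, t) \<in> r - Id \<longrightarrow> (the (f t), the (f s)) \<in> r - Id)"

definition strongly_strictly_decreasing :: "'a rel \<Rightarrow> ('a \<rightharpoonup> 'a) \<Rightarrow> bool" where
  "strongly_strictly_decreasing r f \<longleftrightarrow> strictly_decreasing r f \<and> dom f \<in> Chains r"

text \<open>
  Points of a \<open>product_topology\<close> over \<open>T \<times> T\<close> are functions that are \<open>undefined\<close> outside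
  \<open>T \<times> T\<close>, hence the \<open>restrict\<close>.
\<close>

definition X_points :: "'a set \<Rightarrow> 'a rel \<Rightarrow> ('a \<times> 'a \<Rightarrow> nat) set" where
  "X_points T r = {restrict (indicator (Map.graph f)) (T \<times> T) | f.
     partial_function_on T f \<and> strongly_strictly_decreasing r f}"

definition X_space :: "'a set \<Rightarrow> 'a rel \<Rightarrow> ('a \<times> 'a \<Rightarrow> nat) topology" where
  "X_space T r =
     subtopology (product_topology (\<lambda>_. discrete_topology {0, 1}) (T \<times> T)) (X_points T r)"


section \<open>Bisequential spaces\<close>

definition neighborhood :: "'a topology \<Rightarrow> 'a \<Rightarrow> 'a set \<Rightarrow> bool" where
  "neighborhood X x N \<longleftrightarrow> N \<subseteq> topspace X \<and> x \<in> X interior_of N"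

definition sets_converge_to :: "'a topology \<Rightarrow> (nat \<Rightarrow> 'a set) \<Rightarrow> 'a \<Rightarrow> bool" where
  "sets_converge_to X A x \<longleftrightarrow> (\<forall>n. A n \<noteq> {} \<and> A n \<subseteq> topspace X) \<and>
     (\<forall>N. neighborhood X x N \<longrightarrow> (\<exists>n0. \<forall>n>n0. A n \<subseteq> N))"

definition ultrafilter_on :: "'a set \<Rightarrow> 'a set set \<Rightarrow> bool" where
  "ultrafilter_on S \<U> \<longleftrightarrow> \<U> \<subseteq> Pow S \<and> S \<in> \<U> \<and> {} \<notin> \<U> \<and>
     (\<forall>A\<in>\<U>. \<forall>B\<in>\<U>. A \<inter> B \<in> \<U>) \<and>
     (\<forall>A\<in>\<U>. \<forall>B. A \<subseteq> B \<and> B \<subseteq> S \<longrightarrow> B \<in> \<U>) \<and>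
     (\<forall>A. A \<subseteq> S \<longrightarrow> A \<in> \<U> \<or> S - A \<in> \<U>)"

definition ultrafilter_converges_to :: "'a topology \<Rightarrow> 'a set set \<Rightarrow> 'a \<Rightarrow> bool" where
  "ultrafilter_converges_to X \<U> x \<longleftrightarrow> (\<forall>N. neighborhood X x N \<longrightarrow> N \<in> \<U>)"

definition bisequential_at :: "'a topology \<Rightarrow> 'a \<Rightarrow> bool" where
  "bisequential_at X x \<longleftrightarrow>
     (\<forall>\<U>. ultrafilter_on (topspace X) \<U> \<and> ultrafilter_converges_to X \<U> x \<longrightarrow>
       (\<exists>U::nat \<Rightarrow> 'a set. range U \<subseteq> \<U> \<and> decseq U \<and> sets_converge_to X U x))"

definition bisequential_space :: "'a topology \<Rightarrow> bool" where
  "bisequential_space X \<longleftrightarrow> (\<forall>x\<in>topspace X. bisequential_at X x)"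

end

theory Submission
  imports Defs
begin

text \<open>
  A point of \<open>X_space T r\<close> is the graph of a partial function whose domain is a chain, and an
  ultrafilter \<open>\<U>\<close> converging to \<open>x\<close> says, coordinate by coordinate, that \<open>\<U>\<close>-almost every
  \<open>y\<close> agrees with \<open>x\<close> there. Call \<open>A \<subseteq> T \<times> T\<close> \<^emph>\<open>tame\<close> if \<open>\<U>\<close>-almost every \<open>y\<close> agrees with \<open>x\<close> on
  all of \<open>A\<close> at once. Neighbourhoods only see finitely many coordinates, so a decreasing sequence
  in \<open>\<U>\<close> converging to \<open>x\<close> exists as soon as \<open>T \<times> T\<close> is a countable union of tame sets
  (\<open>bisequential_at_if_countable_cover\<close>).

  Such a cover comes from a dichotomy for a chain \<open>K y\<close> of \<open>T\<close> depending on \<open>y\<close>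
  (\<open>countable_cover_by_points_and_missed_sets\<close>). The nodes that almost surely lie below some
  element of \<open>K y\<close> form a downward closed chain \<open>b\<close>, because two such nodes lie below a common
  element for some \<open>y\<close>. In an Aronszajn tree \<open>b\<close> is countable, and as the levels are countable too,
  only countably many nodes leave \<open>b\<close> immediately. Hence \<open>T\<close> is the union of countably many points,
  those of \<open>b\<close>, and of countably many cones, each of which \<open>K y\<close> almost surely misses.

  Applied to the domain of \<open>y\<close>, the dichotomy reduces the problem to countably many fibres
  \<open>{t} \<times> T\<close>; applied to the set of values of \<open>y\<close> at \<open>t\<close>, which has at most one element and so is a
  chain, it covers each fibre by points and sets that are almost surely missed.
  A point is tame by convergence, and a set that almost every \<open>y\<close> misses is missed by \<open>x\<close> too,
  hence tame.
\<close>

section \<open>Countability in Aronszajn trees\<close>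

lemma is_tree_order:
  assumes "is_tree T r"
  shows "r \<subseteq> T \<times> T" "\<And>t. t \<in> T \<Longrightarrow> (t, t) \<in> r"
    "\<And>s t u. (s, t) \<in> r \<Longrightarrow> (t, u) \<in> r \<Longrightarrow> (s, u) \<in> r"
    "\<And>s t. (s, t) \<in> r \<Longrightarrow> (t, s) \<in> r \<Longrightarrow> s = t"
proof -
  have po: "preorder_on T r" "antisym r"
    using assms unfolding is_tree_def partial_order_on_def by blast+
  then have ro: "r \<subseteq> T \<times> T" "refl_on T r" and "trans r"
    unfolding preorder_on_def by blast+
  show "r \<subseteq> T \<times> T"
    by (rule ro(1))
  show "(t, t) \<in> r" if "t \<in> T" for t
    using that ro(2) by (rule refl_onD[rotated])
  show "(s, u) \<in> r" if "(s, t) \<in> r" "(t, u) \<in> r" for s t u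
    using \<open>trans r\<close> that by (rule transD)
  show "s = t" if "(s, t) \<in> r" "(t, s) \<in> r" for s t
    using po(2) that by (rule antisymD)
qed

lemma is_tree_comparable_below:
  assumes tree: "is_tree T r" and "(s, u) \<in> r" "(t, u) \<in> r"
  shows "(s, t) \<in> r \<or> (t, s) \<in> r"
proof (cases "s = u \<or> t = u")
  case False
  have "u \<in> T"
    using is_tree_order(1)[OF tree] assms(2) by auto
  then have "total_on (underS r u) (Restr r (underS r u))"
    using tree unfolding is_tree_def well_order_on_def linear_order_on_def by blast
  moreover have "s \<in> underS r u" "t \<in> underS r u"
    using False assms(2,3) by (auto simp: underS_def)
  moreover have "(s, s) \<in> r"
    using is_tree_order(1,2)[OF tree] assms(2) by blast
  ultimately show ?thesis
    by (cases "s = t") (auto simp: total_on_def)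
qed (use assms in auto)

lemma is_tree_minimal_below:
  assumes tree: "is_tree T r" and "A \<subseteq> T" "t \<in> A"
  obtains m where "m \<in> A" "(m, t) \<in> r" "underS r m \<inter> A = {}"
proof (cases "underS r t \<inter> A = {}")
  case True
  then show ?thesis
    using that is_tree_order(2)[OF tree] assms(2,3) by blast
next
  case False
  then obtain a where a: "a \<in> underS r t \<inter> A"
    by blast
  have "wf (Restr r (underS r t) - Id)"
    using tree assms(2,3) unfolding is_tree_def well_order_on_def by blast
  from wfE_min[OF this a] obtain m where m: "m \<in> underS r t \<inter> A"
    and min: "\<And>y. (y, m) \<in> Restr r (underS r t) - Id \<Longrightarrow> y \<notin> underS r t \<inter> A"
    by blast
  have "underS r m \<inter> A = {}"
  proof (rule equals0I)
    fix y assume y: "y \<in> underS r m \<inter> A"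
    then have "y \<in> underS r t"
      using m is_tree_order(3,4)[OF tree] unfolding underS_def by blast
    then show False
      using min[of y] y m by (auto simp: underS_def)
  qed
  then show ?thesis
    using that m by (auto simp: underS_def)
qed

text \<open>By Zorn's lemma a chain extends to a branch, and branches are countable.\<close>

lemma aronszajn_tree_countable_chain:
  assumes ar: "aronszajn_tree T r" and b: "b \<in> Chains r"
  shows "countable b"
proof -
  let ?\<A> = "{C \<in> Chains r. b \<subseteq> C}"
  have "\<exists>M\<in>?\<A>. \<forall>X\<in>?\<A>. M \<subseteq> X \<longrightarrow> X = M"
  proof (rule subset_Zorn_nonempty)
    show "?\<A> \<noteq> {}"
      using b by blast
  next
    fix \<C> assume ne: "\<C> \<noteq> {}" and ch: "subset.chain ?\<A> \<C>"
    then have sub: "\<C> \<subseteq> ?\<A>" and total: "\<And>C D. C \<in> \<C> \<Longrightarrow> D \<in> \<C> \<Longrightarrow> C \<subseteq> D \<or> D \<subseteq> C"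
      unfolding subset_chain_def by blast+
    have "\<Union>\<C> \<in> Chains r"
      unfolding Chains_def
    proof (intro CollectI ballI)
      fix s t assume "s \<in> \<Union>\<C>" "t \<in> \<Union>\<C>"
      then obtain C D where "C \<in> \<C>" "D \<in> \<C>" "s \<in> C" "t \<in> D"
        by blast
      then obtain E where "E \<in> \<C>" "s \<in> E" "t \<in> E"
        using total[of C D] by blast
      moreover from this have "E \<in> Chains r"
        using sub by blast
      ultimately show "(s, t) \<in> r \<or> (t, s) \<in> r"
        unfolding Chains_def by blast
    qed
    then show "\<Union>\<C> \<in> ?\<A>"
      using ne sub by blast
  qed
  then obtain M where "M \<in> Chains r" "b \<subseteq> M" and max: "\<forall>X\<in>?\<A>. M \<subseteq> X \<longrightarrow> X = M"
    by blast
  then have "branch r M"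
    unfolding branch_def by (auto dest: subset_trans)
  then show ?thesis
    using ar \<open>b \<subseteq> M\<close> unfolding aronszajn_tree_def by (meson countable_subset)
qed

text \<open>
  Nodes with the same set of predecessors share a level, and the predecessors of a node that leaves
  \<open>b\<close> immediately form an initial segment of \<open>b\<close>: either all of \<open>b\<close> or the predecessors of some
  element of \<open>b\<close>. So these nodes lie on countably many levels.
\<close>

lemma aronszajn_tree_countable_exits:
  assumes ar: "aronszajn_tree T r" and chain: "b \<in> Chains r" and sub: "b \<subseteq> T"
    and down: "\<And>s t. (s, t) \<in> r \<Longrightarrow> t \<in> b \<Longrightarrow> s \<in> b"
  shows "countable {s \<in> T - b. underS r s \<subseteq> b}" (is "countable ?D")
proof -
  have tree: "is_tree T r"
    using ar unfolding aronszajn_tree_def by blast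
  have same: "countable {s \<in> T. underS r s = A}" for A
  proof (cases "\<exists>s\<in>T. underS r s = A")
    case True
    then have "well_order_on A (Restr r A)"
      using tree unfolding is_tree_def by blast
    then have wo: "Well_order (Restr r A)"
      using well_order_on_Well_order[of A "Restr r A"] by blast
    have "{s \<in> T. underS r s = A} \<subseteq> level T r (Restr r A)"
      using ordIso_reflexive[OF wo] unfolding level_def by auto
    then show ?thesis
      using ar wo unfolding aronszajn_tree_def by (meson countable_subset)
  next
    case False
    then have "{s \<in> T. underS r s = A} = {}"
      by blast
    then show ?thesis
      by (metis countable_empty)
  qed
  have exits: "underS r s \<in> insert b (underS r ` b)" if s: "s \<in> ?D" for s
  proof (cases "b \<subseteq> underS r s")
    case False
    then obtain t where t: "t \<in> b - underS r s"
      by blast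
    have "b - underS r s \<subseteq> T"
      using sub by blast
    from is_tree_minimal_below[OF tree this t] obtain m
      where m: "m \<in> b - underS r s" "underS r m \<inter> (b - underS r s) = {}"
      by metis
    have "underS r m \<subseteq> b"
    proof
      fix v assume "v \<in> underS r m"
      then show "v \<in> b"
        using m(1) down[of v m] by (simp add: underS_def)
    qed
    then have "underS r m \<subseteq> underS r s"
      using m(2) by blast
    moreover have "underS r s \<subseteq> underS r m"
    proof
      fix v assume v: "v \<in> underS r s"
      then have "v \<in> b"
        using s by blast
      then have "(v, m) \<in> r \<or> (m, v) \<in> r"
        using chain m(1) unfolding Chains_def by blast
      moreover have "(m, v) \<notin> r"
        using m(1) s v is_tree_order(3)[OF tree, of m v s] by (auto simp: underS_def)
      ultimately show "v \<in> underS r m"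
        using m(1) v by (auto simp: underS_def)
    qed
    ultimately have "underS r s = underS r m"
      by (rule subset_antisym[rotated])
    then show ?thesis
      using m(1) by simp
  next
    case True
    then have "underS r s = b"
      using s by blast
    then show ?thesis
      by simp
  qed
  have "?D \<subseteq> (\<Union>A\<in>insert b (underS r ` b). {s \<in> T. underS r s = A})"
  proof
    fix s assume s: "s \<in> ?D"
    then have "underS r s \<in> insert b (underS r ` b)"
      by (rule exits)
    then show "s \<in> (\<Union>A\<in>insert b (underS r ` b). {s \<in> T. underS r s = A})"
      using s by (intro UN_I) auto
  qed
  moreover have "countable (insert b (underS r ` b))"
    using aronszajn_tree_countable_chain[OF ar chain] by simp
  then have "countable (\<Union>A\<in>insert b (underS r ` b). {s \<in> T. underS r s = A})"
    using same by (rule countable_UN)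
  ultimately show ?thesis
    by (rule countable_subset)
qed


section \<open>Chains chosen by an ultrafilter\<close>

lemma ultrafilter_on_rules:
  assumes "ultrafilter_on S \<U>"
  shows "S \<in> \<U>" "{} \<notin> \<U>" "\<And>A B. A \<in> \<U> \<Longrightarrow> B \<in> \<U> \<Longrightarrow> A \<inter> B \<in> \<U>"
    "\<And>A B. A \<in> \<U> \<Longrightarrow> A \<subseteq> B \<Longrightarrow> B \<subseteq> S \<Longrightarrow> B \<in> \<U>"
    "\<And>A. A \<subseteq> S \<Longrightarrow> A \<notin> \<U> \<Longrightarrow> S - A \<in> \<U>"
  using assms unfolding ultrafilter_on_def by (simp_all, metis)

text \<open>
  The points are the nodes that lie below \<open>K y\<close> for \<open>\<U>\<close>-almost every \<open>y\<close>, the other sets are the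
  cones above the minimal remaining nodes. A cone above a node that is almost surely not below
  \<open>K y\<close> is disjoint from \<open>K y\<close> for these \<open>y\<close>.
\<close>

lemma countable_cover_by_points_and_missed_sets:
  assumes ar: "aronszajn_tree T r" and uf: "ultrafilter_on S \<U>"
    and K: "\<forall>y\<in>S. K y \<in> Chains r"
  shows "\<exists>C \<P>. countable C \<and> countable \<P> \<and> T = C \<union> \<Union>\<P> \<and>
    (\<forall>A\<in>\<P>. {y \<in> S. K y \<inter> A = {}} \<in> \<U>)"
proof -
  have tree: "is_tree T r"
    using ar unfolding aronszajn_tree_def by blast
  note ord = is_tree_order[OF tree]
  note uf = ultrafilter_on_rules[OF uf]
  define B where "B t = {y \<in> S. \<exists>v\<in>K y. (t, v) \<in> r}" for t
  define b where "b = {t \<in> T. B t \<in> \<U>}"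
  define D where "D = {s \<in> T - b. underS r s \<subseteq> b}"
  define cone where "cone s = {t. (s, t) \<in> r}" for s
  have "b \<in> Chains r"
    unfolding Chains_def
  proof (intro CollectI ballI)
    fix s t assume "s \<in> b" "t \<in> b"
    then have "B s \<inter> B t \<in> \<U>"
      using uf(3) unfolding b_def by simp
    then have "B s \<inter> B t \<noteq> {}"
      using uf(2) by metis
    then obtain y v w where "y \<in> S" "v \<in> K y" "w \<in> K y" "(s, v) \<in> r" "(t, w) \<in> r"
      unfolding B_def by blast
    moreover from this have "(v, w) \<in> r \<or> (w, v) \<in> r"
      using K unfolding Chains_def by blast
    ultimately obtain u where "(s, u) \<in> r" "(t, u) \<in> r"
      using ord(3) by blast
    then show "(s, t) \<in> r \<or> (t, s) \<in> r"
      using is_tree_comparable_below[OF tree] by blast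
  qed
  moreover have "b \<subseteq> T"
    unfolding b_def by blast
  moreover have "s \<in> b" if "(s, t) \<in> r" "t \<in> b" for s t
  proof -
    have "B t \<subseteq> B s" "B s \<subseteq> S"
      using that(1) ord(3) unfolding B_def by blast+
    then have "B s \<in> \<U>"
      using that(2) uf(4)[of "B t" "B s"] unfolding b_def by simp
    then show ?thesis
      using that(1) ord(1) unfolding b_def by blast
  qed
  ultimately have "countable b" "countable D"
    using aronszajn_tree_countable_chain[OF ar] aronszajn_tree_countable_exits[OF ar, of b]
    unfolding D_def by simp_all
  moreover have "T = b \<union> \<Union>(cone ` D)"
  proof
    show "b \<union> \<Union>(cone ` D) \<subseteq> T"
      using ord(1) unfolding b_def cone_def by blast
    show "T \<subseteq> b \<union> \<Union>(cone ` D)"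
    proof
      fix t assume "t \<in> T"
      show "t \<in> b \<union> \<Union>(cone ` D)"
      proof (cases "t \<in> b")
        case False
        then have "t \<in> T - b"
          using \<open>t \<in> T\<close> by blast
        from is_tree_minimal_below[OF tree Diff_subset this] obtain m
          where "m \<in> T - b" "(m, t) \<in> r" "underS r m \<inter> (T - b) = {}"
          by metis
        moreover have "underS r m \<subseteq> T"
          using ord(1) unfolding underS_def by blast
        ultimately show ?thesis
          unfolding D_def cone_def by blast
      qed auto
    qed
  qed
  moreover have "{y \<in> S. K y \<inter> A = {}} \<in> \<U>" if "A \<in> cone ` D" for A
  proof -
    obtain s where s: "s \<in> D" "A = cone s"
      using \<open>A \<in> cone ` D\<close> by blast
    moreover have "B s \<subseteq> S"
      unfolding B_def by blast
    ultimately have "S - B s \<in> \<U>"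
      using uf(5) unfolding D_def b_def by simp
    moreover have "S - B s = {y \<in> S. K y \<inter> A = {}}"
      using s(2) unfolding B_def cone_def by blast
    ultimately show ?thesis
      by simp
  qed
  ultimately show ?thesis
    by (intro exI[of _ b] exI[of _ "cone ` D"]) simp
qed


section \<open>Bisequentiality in powers of a discrete space\<close>

text \<open>
  The \<open>n\<close>-th set of the sequence consists of the points that agree with \<open>x\<close> on the first \<open>n + 1\<close>
  pieces of the cover; finitely many coordinates are covered at a finite stage.
\<close>

lemma bisequential_at_if_countable_cover:
  fixes S :: "('i \<Rightarrow> 'b) set" and E :: "'b set" and I :: "'i set"
  defines "X \<equiv> subtopology (product_topology (\<lambda>_. discrete_topology E) I) S"
  assumes S: "S \<subseteq> I \<rightarrow>\<^sub>E E" and x: "x \<in> S"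
    and cover: "\<And>\<U>. ultrafilter_on S \<U> \<Longrightarrow> \<forall>i\<in>I. {y \<in> S. y i = x i} \<in> \<U> \<Longrightarrow>
      \<exists>\<P>. countable \<P> \<and> I \<subseteq> \<Union>\<P> \<and> (\<forall>A\<in>\<P>. {y \<in> S. \<forall>i\<in>A. y i = x i} \<in> \<U>)"
  shows "bisequential_at X x"
proof -
  have top: "topspace X = S"
    using S unfolding X_def by auto
  show ?thesis
    unfolding bisequential_at_def top
  proof (intro allI impI, elim conjE)
    fix \<U> assume uf: "ultrafilter_on S \<U>" and conv: "ultrafilter_converges_to X \<U> x"
    have "\<forall>i\<in>I. {y \<in> S. y i = x i} \<in> \<U>"
    proof
      fix i assume "i \<in> I"
      have "x i \<in> E"
        using S x \<open>i \<in> I\<close> by blast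
      then have "openin (discrete_topology E) {x i}"
        by simp
      moreover have "continuous_map X (discrete_topology E) (\<lambda>y. y i)"
        unfolding X_def using continuous_map_product_projection[OF \<open>i \<in> I\<close>]
        by (rule continuous_map_from_subtopology)
      ultimately have "openin X {y \<in> topspace X. y i \<in> {x i}}"
        by (rule openin_continuous_map_preimage[rotated])
      then have "openin X {y \<in> S. y i = x i}"
        by (simp add: top)
      then have "neighborhood X x {y \<in> S. y i = x i}"
        using x unfolding neighborhood_def by (auto simp: interior_of_openin top)
      then show "{y \<in> S. y i = x i} \<in> \<U>"
        using conv unfolding ultrafilter_converges_to_def by simp
    qed
    from cover[OF uf this] obtain \<P> where \<P>: "countable \<P>" "I \<subseteq> \<Union>\<P>"
      "\<forall>A\<in>\<P>. {y \<in> S. \<forall>i\<in>A. y i = x i} \<in> \<U>"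
      by (elim exE conjE)
    \<comment> \<open>The extra empty piece allows an enumeration even if \<open>\<P>\<close> is empty.\<close>
    define P where "P = from_nat_into (insert {} \<P>)"
    have range_P: "range P = insert {} \<P>"
      unfolding P_def using \<P>(1) by (intro range_from_nat_into) auto
    have S_in: "S \<in> \<U>" and ne: "{} \<notin> \<U>"
      by (rule ultrafilter_on_rules[OF uf])+
    have agree: "{y \<in> S. \<forall>i\<in>P n. y i = x i} \<in> \<U>" for n
    proof -
      have "P n = {} \<or> P n \<in> \<P>"
        using range_P by blast
      then show ?thesis
        using \<P>(3) S_in by auto
    qed
    define U where "U n = {y \<in> S. \<forall>k\<le>n. \<forall>i\<in>P k. y i = x i}" for n :: nat
    have U_in: "U n \<in> \<U>" for n
    proof (induction n)
      case 0
      show ?case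
        using agree[of 0] unfolding U_def by simp
    next
      case (Suc n)
      have "U (Suc n) = U n \<inter> {y \<in> S. \<forall>i\<in>P (Suc n). y i = x i}"
        unfolding U_def by (auto simp: le_Suc_eq)
      then show ?case
        using Suc agree[of "Suc n"] ultrafilter_on_rules(3)[OF uf] by simp
    qed
    have "decseq U"
      unfolding decseq_def U_def by (auto dest: order_trans)
    moreover have "sets_converge_to X U x"
      unfolding sets_converge_to_def
    proof (intro conjI allI impI)
      fix n
      show "U n \<noteq> {}"
        using U_in[of n] ne by metis
      show "U n \<subseteq> topspace X"
        unfolding top U_def by blast
    next
      fix N assume "neighborhood X x N"
      then obtain O' where O': "openin X O'" "x \<in> O'" "O' \<subseteq> N"
        unfolding neighborhood_def interior_of_def by auto
      then obtain W where W: "openin (product_topology (\<lambda>_. discrete_topology E) I) W"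
        and "O' = W \<inter> S"
        unfolding X_def openin_subtopology by auto
      then have "x \<in> W" "W \<inter> S \<subseteq> N"
        using O' by simp_all
      from W[unfolded openin_product_topology_alt topspace_discrete_topology, rule_format,
          OF \<open>x \<in> W\<close>]
      obtain V where V: "finite {i \<in> I. V i \<noteq> E}" "x \<in> Pi\<^sub>E I V" "Pi\<^sub>E I V \<subseteq> W"
        by (elim exE conjE)
      have "\<forall>i\<in>I. \<exists>k. i \<in> P k"
        using \<P>(2) range_P by blast
      then obtain k where k: "\<And>i. i \<in> I \<Longrightarrow> i \<in> P (k i)"
        by metis
      obtain n0 where n0: "\<And>i. i \<in> {i \<in> I. V i \<noteq> E} \<Longrightarrow> k i \<le> n0"
        using finite_nat_set_iff_bounded_le[of "k ` {i \<in> I. V i \<noteq> E}"] V(1) by auto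
      have "U n \<subseteq> N" if "n > n0" for n
      proof
        fix y assume y: "y \<in> U n"
        then have yS: "y \<in> S"
          unfolding U_def by blast
        have "y i \<in> V i" if "i \<in> I" for i
        proof (cases "V i = E")
          case True
          then show ?thesis
            using yS S that by blast
        next
          case False
          then have "k i \<le> n"
            using n0[of i] that \<open>n > n0\<close> by simp
          then have "y i = x i"
            using y k[OF that] unfolding U_def by blast
          then show ?thesis
            using V(2) that by auto
        qed
        then have "y \<in> Pi\<^sub>E I V"
          using yS S by (auto simp: PiE_iff)
        then show "y \<in> N"
          using V(3) \<open>W \<inter> S \<subseteq> N\<close> yS by blast
      qed
      then show "\<exists>n0. \<forall>n>n0. U n \<subseteq> N"
        by blast
    qed
    moreover have "range U \<subseteq> \<U>"
      using U_in by (rule image_subsetI)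
    ultimately show "\<exists>U. range U \<subseteq> \<U> \<and> decseq U \<and> sets_converge_to X U x"
      by (intro exI[of _ U] conjI)
  qed
qed


section \<open>The space of strongly strictly decreasing functions\<close>

lemma X_points_cases:
  assumes "y \<in> X_points T r"
  shows "\<exists>f. y = restrict (indicator (Map.graph f)) (T \<times> T) \<and> dom f \<in> Chains r \<and>
    (\<forall>t\<in>T. \<forall>u\<in>T. y (t, u) = 1 \<longleftrightarrow> f t = Some u)"
proof -
  obtain f where f: "y = restrict (indicator (Map.graph f)) (T \<times> T)" "dom f \<in> Chains r"
    using assms unfolding X_points_def strongly_strictly_decreasing_def by blast
  moreover have "\<forall>t\<in>T. \<forall>u\<in>T. y (t, u) = 1 \<longleftrightarrow> f t = Some u"
    unfolding f(1) Map.graph_def by (simp add: indicator_def)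
  ultimately show ?thesis
    by blast
qed

lemma X_points_subset_PiE: "X_points T r \<subseteq> T \<times> T \<rightarrow>\<^sub>E {0, 1}"
proof
  fix y assume "y \<in> X_points T r"
  then obtain f where "y = restrict (indicator (Map.graph f)) (T \<times> T)"
    using X_points_cases by metis
  then show "y \<in> T \<times> T \<rightarrow>\<^sub>E {0, 1}"
    by (simp add: restrict_PiE_iff indicator_def)
qed

lemma X_points_domain_chain:
  assumes "y \<in> X_points T r"
  shows "{t \<in> T. \<exists>u\<in>T. y (t, u) = 1} \<in> Chains r"
proof -
  obtain f where f: "dom f \<in> Chains r" "\<forall>t\<in>T. \<forall>u\<in>T. y (t, u) = 1 \<longleftrightarrow> f t = Some u"
    using X_points_cases[OF assms] by metis
  then have "{t \<in> T. \<exists>u\<in>T. y (t, u) = 1} \<subseteq> dom f"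
    by auto
  then show ?thesis
    using f(1) unfolding Chains_def by blast
qed

lemma X_points_value_unique:
  assumes "y \<in> X_points T r" "t \<in> T" "u \<in> T" "v \<in> T" "y (t, u) = 1" "y (t, v) = 1"
  shows "u = v"
proof -
  obtain f where "\<forall>t\<in>T. \<forall>u\<in>T. y (t, u) = 1 \<longleftrightarrow> f t = Some u"
    using X_points_cases[OF assms(1)] by metis
  then have "f t = Some u" "f t = Some v"
    using assms(2-) by blast+
  then show ?thesis
    by simp
qed

text \<open>
  Almost every point is zero on \<open>A\<close>, and so is \<open>x\<close>: if \<open>x i = 1\<close> for some \<open>i \<in> A\<close>, then by
  convergence almost every point would also take the value \<open>1\<close> at \<open>i\<close>.
\<close>

lemma limit_agrees_on_missed_set:
  fixes S :: "('i \<Rightarrow> nat) set"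
  assumes uf: "ultrafilter_on S \<U>" and S: "S \<subseteq> I \<rightarrow>\<^sub>E {0, 1}" and x: "x \<in> S" and A: "A \<subseteq> I"
    and conv: "\<forall>i\<in>I. {y \<in> S. y i = x i} \<in> \<U>"
    and missed: "{y \<in> S. \<forall>i\<in>A. y i \<noteq> 1} \<in> \<U>" (is "?M \<in> \<U>")
  shows "{y \<in> S. \<forall>i\<in>A. y i = x i} \<in> \<U>"
proof -
  have zero: "y i = 0" if "y \<in> S" "i \<in> A" "y i \<noteq> 1" for y i
    using that S A by (auto simp: PiE_iff)
  have "x i \<noteq> 1" if "i \<in> A" for i
  proof
    assume "x i = 1"
    then have "?M \<inter> {y \<in> S. y i = x i} = {}"
      using that by auto
    moreover have "i \<in> I"
      using that A by blast
    then have "?M \<inter> {y \<in> S. y i = x i} \<in> \<U>"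
      using ultrafilter_on_rules(3)[OF uf missed bspec[OF conv]] by simp
    ultimately show False
      using ultrafilter_on_rules(2)[OF uf] by simp
  qed
  then have "y i = x i" if "y \<in> ?M" "i \<in> A" for y i
    using that zero[of y i] zero[OF x, of i] by simp
  then have "?M \<subseteq> {y \<in> S. \<forall>i\<in>A. y i = x i}"
    by blast
  moreover have "{y \<in> S. \<forall>i\<in>A. y i = x i} \<subseteq> S"
    by blast
  ultimately show ?thesis
    using ultrafilter_on_rules(4)[OF uf missed] by simp
qed

theorem corollary3p7:
  fixes T :: "'a set" and r :: "'a rel"
  assumes "aronszajn_tree T r"
  shows "bisequential_space (X_space T r)"
proof -
  define S where "S = X_points T r"
  have tree: "is_tree T r"
    using assms unfolding aronszajn_tree_def by blast
  have S: "S \<subseteq> T \<times> T \<rightarrow>\<^sub>E {0, 1}"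
    unfolding S_def by (rule X_points_subset_PiE)
  have "bisequential_at (X_space T r) x" if x: "x \<in> S" for x
    unfolding X_space_def S_def[symmetric]
  proof (rule bisequential_at_if_countable_cover[OF S x])
    fix \<U>
    assume uf: "ultrafilter_on S \<U>" and conv: "\<forall>p\<in>T \<times> T. {y \<in> S. y p = x p} \<in> \<U>"
    have "\<forall>y\<in>S. {t \<in> T. \<exists>u\<in>T. y (t, u) = 1} \<in> Chains r"
      using X_points_domain_chain unfolding S_def by blast
    from countable_cover_by_points_and_missed_sets[OF assms uf this]
    obtain C \<P> where C: "countable C" "countable \<P>" "T = C \<union> \<Union>\<P>"
      "\<forall>A\<in>\<P>. {y \<in> S. {t \<in> T. \<exists>u\<in>T. y (t, u) = 1} \<inter> A = {}} \<in> \<U>"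
      by (elim exE conjE)
    have "\<forall>t\<in>T. \<exists>D \<Q>. countable D \<and> countable \<Q> \<and> T = D \<union> \<Union>\<Q> \<and>
        (\<forall>A\<in>\<Q>. {y \<in> S. {u \<in> T. y (t, u) = 1} \<inter> A = {}} \<in> \<U>)"
    proof
      fix t assume t: "t \<in> T"
      have "\<forall>y\<in>S. {u \<in> T. y (t, u) = 1} \<in> Chains r"
        unfolding S_def Chains_def
      proof (intro ballI CollectI)
        fix y u v
        assume "y \<in> X_points T r" "u \<in> {u \<in> T. y (t, u) = 1}" "v \<in> {u \<in> T. y (t, u) = 1}"
        then have "u = v" "u \<in> T"
          using X_points_value_unique[of y T r t u v] t by simp_all
        then show "(u, v) \<in> r \<or> (v, u) \<in> r"
          using is_tree_order(2)[OF tree] by simp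
      qed
      from countable_cover_by_points_and_missed_sets[OF assms uf this]
      show "\<exists>D \<Q>. countable D \<and> countable \<Q> \<and> T = D \<union> \<Union>\<Q> \<and>
        (\<forall>A\<in>\<Q>. {y \<in> S. {u \<in> T. y (t, u) = 1} \<inter> A = {}} \<in> \<U>)" .
    qed
    then obtain D \<Q> where all: "\<forall>t\<in>T. countable (D t) \<and> countable (\<Q> t) \<and> T = D t \<union> \<Union>(\<Q> t) \<and>
        (\<forall>A\<in>\<Q> t. {y \<in> S. {u \<in> T. y (t, u) = 1} \<inter> A = {}} \<in> \<U>)"
      unfolding bchoice_iff by (elim exE)
    have D: "countable (D t)" "countable (\<Q> t)" "T = D t \<union> \<Union>(\<Q> t)"
      "\<forall>A\<in>\<Q> t. {y \<in> S. {u \<in> T. y (t, u) = 1} \<inter> A = {}} \<in> \<U>" if "t \<in> T" for t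
      by (rule bspec[OF all that, THEN conjunct1]
        bspec[OF all that, THEN conjunct2, THEN conjunct1]
        bspec[OF all that, THEN conjunct2, THEN conjunct2, THEN conjunct1]
        bspec[OF all that, THEN conjunct2, THEN conjunct2, THEN conjunct2])+
    have CT: "C \<subseteq> T"
      using C(3) by blast
    define \<R> where "\<R> = (\<lambda>A. A \<times> T) ` \<P> \<union>
      (\<Union>t\<in>C. (\<lambda>A. {t} \<times> A) ` \<Q> t \<union> (\<lambda>u. {(t, u)}) ` D t)"
    have "countable \<R>"
      unfolding \<R>_def using C(1,2) D(1,2) CT
      by (intro countable_Un countable_image countable_UN) auto
    moreover have "T \<times> T \<subseteq> \<Union>\<R>"
    proof
      fix p assume "p \<in> T \<times> T"
      then obtain t u where p: "p = (t, u)" "t \<in> T" "u \<in> T"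
        by (rule SigmaE)
      show "p \<in> \<Union>\<R>"
      proof (cases "t \<in> C")
        case True
        have "u \<in> D t \<union> \<Union>(\<Q> t)"
          by (rule subsetD[OF equalityD1[OF D(3)[OF p(2)]] p(3)])
        then consider "u \<in> D t" | A where "A \<in> \<Q> t" "u \<in> A"
          by auto
        then show ?thesis
        proof cases
          case 1
          then have "{(t, u)} \<in> \<R>"
            using True unfolding \<R>_def by blast
          then show ?thesis
            using p(1) by (intro UnionI) auto
        next
          case 2
          then have "{t} \<times> A \<in> \<R>"
            using True unfolding \<R>_def by blast
          then show ?thesis
            using p(1) 2(2) by (intro UnionI) auto
        qed
      next
        case False
        then obtain A where "A \<in> \<P>" "t \<in> A"
          using subsetD[OF equalityD1[OF C(3)] p(2)] by auto
        then have "A \<times> T \<in> \<R>" "p \<in> A \<times> T"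
          using p unfolding \<R>_def by simp_all
        then show ?thesis
          by (rule UnionI)
      qed
    qed
    moreover have "{y \<in> S. \<forall>p\<in>R. y p = x p} \<in> \<U>" if "R \<in> \<R>" for R
    proof -
      consider (strip) A where "A \<in> \<P>" "R = A \<times> T"
        | (fibre) t A where "t \<in> C" "A \<in> \<Q> t" "R = {t} \<times> A"
        | (point) t u where "t \<in> C" "u \<in> D t" "R = {(t, u)}"
        using \<open>R \<in> \<R>\<close> unfolding \<R>_def by blast
      then show ?thesis
      proof cases
        case strip
        then have "A \<subseteq> T"
          using equalityD2[OF C(3)] by blast
        then have "{y \<in> S. {t \<in> T. \<exists>u\<in>T. y (t, u) = 1} \<inter> A = {}} = {y \<in> S. \<forall>p\<in>R. y p \<noteq> 1}"
          unfolding strip(2) by blast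
        then show ?thesis
          using bspec[OF C(4) strip(1)] strip(2) \<open>A \<subseteq> T\<close>
          by (intro limit_agrees_on_missed_set[OF uf S x _ conv]) auto
      next
        case fibre
        then have "t \<in> T"
          using CT by blast
        then have "A \<subseteq> T"
          using equalityD2[OF D(3)[OF \<open>t \<in> T\<close>]] fibre(2) by blast
        then have "{y \<in> S. {u \<in> T. y (t, u) = 1} \<inter> A = {}} = {y \<in> S. \<forall>p\<in>R. y p \<noteq> 1}"
          unfolding fibre(3) by blast
        then show ?thesis
          using bspec[OF D(4)[OF \<open>t \<in> T\<close>] fibre(2)] fibre(3) \<open>A \<subseteq> T\<close> \<open>t \<in> T\<close>
          by (intro limit_agrees_on_missed_set[OF uf S x _ conv]) auto
      next
        case point
        then have "t \<in> T"
          using CT by blast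
        then have "(t, u) \<in> T \<times> T"
          using equalityD2[OF D(3)[OF \<open>t \<in> T\<close>]] point(2) by blast
        then show ?thesis
          using bspec[OF conv] point(3) by simp
      qed
    qed
    ultimately show "\<exists>\<R>. countable \<R> \<and> T \<times> T \<subseteq> \<Union>\<R> \<and>
        (\<forall>R\<in>\<R>. {y \<in> S. \<forall>p\<in>R. y p = x p} \<in> \<U>)"
      by blast
  qed
  moreover have "topspace (X_space T r) = S"
    using S unfolding X_space_def S_def[symmetric] topspace_subtopology topspace_product_topology
      topspace_discrete_topology by (rule Int_absorb1)
  ultimately show ?thesis
    unfolding bisequential_space_def by blast
qed

end
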